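(* For all $k\in\mathbb{N}$, all $\varepsilon\in(0,1)$, all finite groups $(G,+)$ and $(H,\oplus)$, and all functions $f:G\to H$ that are $\varepsilon$-far from being a homomorphism, \[\Pr[\mathsf{RandomSignsTest}_{2k}\text{ rejects } f]\ \ge\ \min\Big\{\frac{(2k-3)\varepsilon}{3},\ \frac{1}{16}\Big\}.\]
   Context: $\mathsf{RandomSignsTest}_k$ (no adversary, direct query access to $f$): draw $x_1,\dots,x_k\in G$ and signs $\sigma_1,\dots,\sigma_k\in\{+,-\}$ independently and uniformly at random; let $a=\sum_{i\in[k]}\sigma_i x_i$; query $f(x_1),\dots,f(x_k),f(a)$; accept iff $\bigoplus_{i\in[k]}\sigma_i f(x_i)=f(a)$, otherwise reject. Here $+b=b$ and $-b$ is the inverse of $b$ (in $G$ or $H$ respectively), and sums are taken in increasing index order (relevant for non-abelian groups). $f$ is $\varepsilon$-far from being a homomorphism if $\Pr_{x\in G}[f(x)\ne h(x)]>\varepsilon$ for every homomorphism $h:G\to H$. *)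

theory Defs
  imports "HOL-Probability.Probability" "HOL-Algebra.Group"
begin

(* Groups are HOL-Algebra structures. Both (G, +) and (H, \<oplus>) of the paper are possibly
   non-abelian, so their operations are the (multiplicatively written) \<otimes> of the structure,
   -b is inv b, and the empty sum is \<one>. *)

datatype sign = Positive | Negative

instance sign :: finite
proof
  have "(UNIV :: sign set) = {Positive, Negative}"
    using sign.exhaust by auto
  then show "finite (UNIV :: sign set)"
    by (metis finite.emptyI finite.insertI)
qed

datatype verdict = Accept | Reject

definition signed :: "('a, 'm) monoid_scheme \<Rightarrow> sign \<Rightarrow> 'a \<Rightarrow> 'a" where
  "signed G s b = (case s of Positive \<Rightarrow> b | Negative \<Rightarrow> inv\<^bsub>G\<^esub> b)"

(* The sum of sigma_i b_i in increasing index order; i-th list entries carry index i + 1. *)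
definition signed_sum :: "('a, 'm) monoid_scheme \<Rightarrow> sign list \<Rightarrow> 'a list \<Rightarrow> 'a" where
  "signed_sum G ss bs = foldr (\<otimes>\<^bsub>G\<^esub>) (map2 (signed G) ss bs) \<one>\<^bsub>G\<^esub>"

(* Meaningful for finite nonempty carrier G, as pmf_of_set is unspecified otherwise. *)
definition random_signs_test ::
    "('a, 'm) monoid_scheme \<Rightarrow> ('b, 'n) monoid_scheme \<Rightarrow> nat \<Rightarrow> ('a \<Rightarrow> 'b) \<Rightarrow> verdict pmf" where
  "random_signs_test G H k f = do {
     xs \<leftarrow> replicate_pmf k (pmf_of_set (carrier G));
     ss \<leftarrow> replicate_pmf k (pmf_of_set (UNIV :: sign set));
     let a = signed_sum G ss xs;
     return_pmf (if signed_sum H ss (map f xs) = f a then Accept else Reject)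
   }"

definition far_from_hom ::
    "('a, 'm) monoid_scheme \<Rightarrow> ('b, 'n) monoid_scheme \<Rightarrow> real \<Rightarrow> ('a \<Rightarrow> 'b) \<Rightarrow> bool" where
  "far_from_hom G H \<epsilon> f \<longleftrightarrow>
     (\<forall>h \<in> hom G H. measure_pmf.prob (pmf_of_set (carrier G)) {x. f x \<noteq> h x} > \<epsilon>)"

end

theory Submission
  imports Defs
begin

text \<open>
  The pairs (signed sum of the points, signed sum of their values) form a random walk on
  \<open>G \<times>\<times> H\<close> whose law is invariant under inversion, because the signs are random. Let \<open>\<delta>\<close> be
  the rejection probability.

  If \<open>\<delta> < 1/16\<close>, take independent walks \<open>u, v, w\<close> of length \<open>k\<close> with \<open>G\<close>-parts \<open>a\<close>. The points
  \<open>x = a\<^sub>u a\<^sub>v\<close> and \<open>y = a\<^sub>v\<^sup>-\<^sup>1 a\<^sub>w\<close> are independent and uniform, and each of \<open>f x\<close>, \<open>f y\<close>, \<open>f (x y)\<close>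
  is given by the corresponding product of \<open>H\<close>-parts up to probability \<open>\<delta>\<close>; so \<open>f (x y) = f x f y\<close>
  fails with probability at most \<open>3 \<delta> < 3/16\<close>. Plurality decoding then yields a homomorphism \<open>g\<close>
  at distance \<open>\<eta> \<le> 4 \<delta> < 1/4\<close> from \<open>f\<close>.

  For the error \<open>e = g(a)\<^sup>-\<^sup>1 b\<close> of a walk \<open>(a, b)\<close>, no value has probability above
  \<open>(1 + (1 - 2 \<eta>)\<^sup>n) / 2\<close> after \<open>n\<close> steps. A walk of length \<open>2 k\<close> has trivial error iff the errors of
  its first half and of its inverted second half collide, so this happens with probability at most
  \<open>(1 + (1 - 2 \<eta>)\<^bsup>2 k\<^esup>) / 2\<close>. Hence \<open>\<delta> + \<eta> \<ge> (1 - (1 - 2 \<eta>)\<^bsup>2 k\<^esup>) / 2\<close>, which suffices by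
  Bernoulli's inequality.
\<close>

section \<open>Collision probabilities\<close>

lemma prob_bind_pmf:
  fixes B :: "'b set"
  shows "measure_pmf.prob (bind_pmf p F) B = measure_pmf.expectation p (\<lambda>x. measure_pmf.prob (F x) B)"
proof -
  \<comment> \<open>An event probability becomes a point mass of a Boolean law, the form that
    \<open>pmf_bind\<close> handles.\<close>
  have eq: "measure_pmf.prob q B = pmf (map_pmf (\<lambda>x. x \<in> B) q) True" for q :: "'b pmf"
    by (simp add: pmf_map vimage_def)
  show ?thesis by (simp add: eq map_bind_pmf pmf_bind)
qed

lemma prob_map_pmf_eq:
  assumes "map_pmf h p = q" "A = h -` B"
  shows "measure_pmf.prob p A = measure_pmf.prob q B"
  using assms by auto

lemma prob_pair_pmf:
  "measure_pmf.prob (pair_pmf p q) B =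
     measure_pmf.expectation p (\<lambda>x. measure_pmf.prob q {y. (x, y) \<in> B})"
proof -
  have "pair_pmf p q = bind_pmf p (\<lambda>x. map_pmf (Pair x) q)"
    by (simp add: pair_pmf_def map_pmf_def)
  then show ?thesis
    by (simp add: prob_bind_pmf vimage_def)
qed

lemma prob_pair_eq:
  "measure_pmf.prob (pair_pmf p q) {(x, y). x = y} = measure_pmf.expectation p (pmf q)"
  by (simp add: prob_pair_pmf pmf.rep_eq flip: singleton_conv2)

lemma pmf_add_le_1:
  assumes "x \<noteq> y"
  shows "pmf q x + pmf q y \<le> 1"
proof -
  have "pmf q x + pmf q y = measure_pmf.prob q {x, y}"
    using assms by (simp add: measure_measure_pmf_finite)
  then show ?thesis by simp
qed

lemma integrable_indicator_pmf [simp]: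
  "integrable (measure_pmf p) (indicator A :: _ \<Rightarrow> real)"
  by (rule measure_pmf.integrable_const_bound[where B = 1]) (auto simp: indicator_def)

text \<open>Pointwise comparison: away from \<open>h\<close>, two distinct points share mass at most
  1, so \<open>pmf q x \<le> 1 - pmf q h\<close>.\<close>

lemma expectation_pmf_le:
  "measure_pmf.expectation p (pmf q) \<le> pmf p h * pmf q h + (1 - pmf p h) * (1 - pmf q h)"
proof -
  let ?b = "pmf q h"
  have "measure_pmf.expectation p (pmf q) \<le>
      measure_pmf.expectation p (\<lambda>x. ?b * indicator {h} x + (1 - ?b) * indicator (- {h}) x)"
  proof (rule integral_mono)
    show "integrable (measure_pmf p) (pmf q)"
      by (rule measure_pmf.integrable_const_bound[where B = 1]) (auto simp: pmf_le_1)
    show "pmf q x \<le> ?b * indicator {h} x + (1 - ?b) * indicator (- {h}) x" for x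
      using pmf_add_le_1[of x h q] by (auto simp: indicator_def)
  qed (intro Bochner_Integration.integrable_add integrable_mult_right integrable_indicator_pmf)
  also have "\<dots> = ?b * measure_pmf.prob p {h} + (1 - ?b) * measure_pmf.prob p (- {h})"
    by (subst Bochner_Integration.integral_add) (auto intro!: integrable_mult_right)
  also have "measure_pmf.prob p (- {h}) = 1 - pmf p h"
    using measure_pmf.prob_compl[of "{h}" p] by (simp add: Compl_eq_Diff_UNIV pmf.rep_eq)
  finally show ?thesis by (simp add: pmf.rep_eq algebra_simps)
qed

text \<open>With a = \<open>pmf p h\<close> and b = \<open>pmf q h\<close>, a b + (1 - a)(1 - b) =
  1/2 + (2 a - 1)(2 b - 1)/2, so biases of the form 2 M - 1 multiply. This is used at an atom
  \<open>h\<close> of \<open>p\<close> of mass at least 1/2; if there is none, any value drawn from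
  \<open>q\<close> is matched with probability at most 1/2.\<close>

lemma collision_le:
  assumes p: "\<And>x. pmf p x \<le> M" and q: "\<And>x. pmf q x \<le> N" and "1/2 \<le> M" "1/2 \<le> N"
  shows "measure_pmf.prob (pair_pmf p q) {(x, y). x = y} \<le> 1/2 + (2 * M - 1) * (2 * N - 1) / 2"
proof (cases "\<exists>h. 1/2 \<le> pmf p h")
  case True
  then obtain h where h: "1/2 \<le> pmf p h" ..
  \<comment> \<open>The choice of \<open>h\<close> makes the first factor nonnegative, so
    \<open>pmf q h\<close> may be raised to \<open>N\<close> even if it is below 1/2.\<close>
  have "(2 * pmf p h - 1) * (2 * pmf q h - 1) \<le> (2 * pmf p h - 1) * (2 * N - 1)"
    using h q[of h] by (intro mult_left_mono) auto
  also have "\<dots> \<le> (2 * M - 1) * (2 * N - 1)"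
    using p[of h] assms(4) by (intro mult_right_mono) auto
  finally show ?thesis
    using expectation_pmf_le[of p q h] by (simp add: prob_pair_eq field_simps)
next
  case False
  have "measure_pmf.prob (pair_pmf p q) {(x, y). x = y} = measure_pmf.expectation q (pmf p)"
    unfolding prob_pair_eq[symmetric] pair_commute_pmf[of p q] measure_map_pmf
    by (rule arg_cong[where f = "measure_pmf.prob _"]) auto
  also have "\<dots> \<le> measure_pmf.expectation q (\<lambda>_. 1/2)"
  proof (rule integral_mono)
    show "integrable (measure_pmf q) (pmf p)"
      by (rule measure_pmf.integrable_const_bound[where B = 1]) (auto simp: pmf_le_1)
  qed (use False in \<open>auto simp: not_le less_imp_le\<close>)
  also have "\<dots> \<le> 1/2 + (2 * M - 1) * (2 * N - 1) / 2"
    using assms(3,4) by simp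
  finally show ?thesis .
qed

section \<open>Union bounds over the support\<close>

lemma prob_mono:
  assumes "\<And>x. x \<in> set_pmf p \<Longrightarrow> x \<in> A \<Longrightarrow> x \<in> B"
  shows "measure_pmf.prob p A \<le> measure_pmf.prob p B"
  using assms by (intro measure_pmf.finite_measure_mono_AE) (auto simp: AE_measure_pmf_iff)

lemma prob_le_add:
  assumes "\<And>x. x \<in> set_pmf p \<Longrightarrow> x \<in> A \<Longrightarrow> x \<in> B \<union> C"
  shows "measure_pmf.prob p A \<le> measure_pmf.prob p B + measure_pmf.prob p C"
proof -
  have "measure_pmf.prob p A \<le> measure_pmf.prob p (B \<union> C)"
    using assms by (rule prob_mono)
  also have "\<dots> \<le> measure_pmf.prob p B + measure_pmf.prob p C"
    by (rule measure_Un_le) auto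
  finally show ?thesis .
qed

text \<open>Probabilistic method: the surviving point lies in the support, hence in the carrier when
  the law is uniform.\<close>

lemma ex_not_in_3:
  assumes "measure_pmf.prob p A + measure_pmf.prob p B + measure_pmf.prob p C < 1"
  obtains x where "x \<in> set_pmf p" "x \<notin> A" "x \<notin> B" "x \<notin> C"
proof (rule ccontr)
  assume "\<not> thesis"
  with that have "\<And>x. x \<in> set_pmf p \<Longrightarrow> x \<in> UNIV \<Longrightarrow> x \<in> A \<union> (B \<union> C)" by blast
  then have "measure_pmf.prob p UNIV \<le> measure_pmf.prob p A + measure_pmf.prob p (B \<union> C)"
    by (rule prob_le_add)
  also have "measure_pmf.prob p (B \<union> C) \<le> measure_pmf.prob p B + measure_pmf.prob p C"
    by (rule prob_le_add) auto
  finally show False using assms by simp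
qed

section \<open>Random walks on groups\<close>

definition conv_pmf :: "('a, 'm) monoid_scheme \<Rightarrow> 'a pmf \<Rightarrow> 'a pmf \<Rightarrow> 'a pmf" where
  "conv_pmf K p q = map_pmf (\<lambda>(a, b). a \<otimes>\<^bsub>K\<^esub> b) (pair_pmf p q)"

text \<open>New steps enter on the left, matching the way \<open>signed_sum\<close> consumes its
  lists from the head.\<close>

primrec walk_pmf :: "('a, 'm) monoid_scheme \<Rightarrow> 'a pmf \<Rightarrow> nat \<Rightarrow> 'a pmf" where
  "walk_pmf K p 0 = return_pmf \<one>\<^bsub>K\<^esub>"
| "walk_pmf K p (Suc n) = conv_pmf K p (walk_pmf K p n)"

lemma conv_pmf_bind:
  "conv_pmf K p q = bind_pmf p (\<lambda>a. bind_pmf q (\<lambda>b. return_pmf (a \<otimes>\<^bsub>K\<^esub> b)))"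
  by (simp add: conv_pmf_def pair_pmf_def map_pmf_def bind_assoc_pmf bind_return_pmf)

context group
begin

lemma mult_inv_cancel_left:
  assumes "x \<in> carrier G" "y \<in> carrier G"
  shows "x \<otimes> (inv x \<otimes> y) = y" "inv x \<otimes> (x \<otimes> y) = y"
  using assms by (simp_all flip: m_assoc)

lemma set_conv_pmf:
  assumes "set_pmf p \<subseteq> carrier G" "set_pmf q \<subseteq> carrier G"
  shows "set_pmf (conv_pmf G p q) \<subseteq> carrier G"
  using assms by (auto simp: conv_pmf_def)

lemma set_walk_pmf:
  assumes "set_pmf p \<subseteq> carrier G"
  shows "set_pmf (walk_pmf G p n) \<subseteq> carrier G"
  by (induction n) (use assms in \<open>auto simp: set_conv_pmf\<close>)

lemma conv_pmf_assoc:
  assumes "set_pmf p \<subseteq> carrier G" "set_pmf q \<subseteq> carrier G" "set_pmf r \<subseteq> carrier G"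
  shows "conv_pmf G (conv_pmf G p q) r = conv_pmf G p (conv_pmf G q r)"
  using assms
  by (auto simp: conv_pmf_bind bind_assoc_pmf bind_return_pmf m_assoc subset_iff intro!: bind_pmf_cong)

lemma conv_one_left:
  assumes "set_pmf p \<subseteq> carrier G"
  shows "conv_pmf G (return_pmf \<one>) p = p"
  using assms by (auto simp: conv_pmf_def pair_return_pmf1 map_pmf_comp intro!: map_pmf_idI)

lemma conv_one_right:
  assumes "set_pmf p \<subseteq> carrier G"
  shows "conv_pmf G p (return_pmf \<one>) = p"
  using assms by (auto simp: conv_pmf_def pair_return_pmf2 map_pmf_comp intro!: map_pmf_idI)

lemma walk_pmf_add:
  assumes "set_pmf p \<subseteq> carrier G"
  shows "walk_pmf G p (m + n) = conv_pmf G (walk_pmf G p m) (walk_pmf G p n)"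
  using assms by (induction m) (simp_all add: conv_one_left conv_pmf_assoc set_walk_pmf)

lemma walk_pmf_Suc_right:
  assumes "set_pmf p \<subseteq> carrier G"
  shows "walk_pmf G p (Suc n) = conv_pmf G (walk_pmf G p n) p"
  using walk_pmf_add[OF assms, of n 1] assms by (simp add: conv_one_right)

lemma map_inv_conv_pmf:
  assumes "set_pmf p \<subseteq> carrier G" "set_pmf q \<subseteq> carrier G"
  shows "map_pmf (m_inv G) (conv_pmf G p q) = conv_pmf G (map_pmf (m_inv G) q) (map_pmf (m_inv G) p)"
proof -
  have "map_pmf (m_inv G) (conv_pmf G p q) =
      bind_pmf p (\<lambda>a. bind_pmf q (\<lambda>b. return_pmf (inv b \<otimes> inv a)))"
    using assms
    by (auto simp: conv_pmf_bind map_bind_pmf inv_mult_group subset_iff intro!: bind_pmf_cong)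
  then show ?thesis
    by (subst (asm) bind_commute_pmf) (simp add: conv_pmf_bind bind_map_pmf)
qed

text \<open>Inversion reverses the order of the steps; they are independent with a common
  inversion-invariant law, so \<open>walk_pmf_Suc_right\<close> restores the walk.\<close>

lemma map_inv_walk_pmf:
  assumes "set_pmf p \<subseteq> carrier G" "map_pmf (m_inv G) p = p"
  shows "map_pmf (m_inv G) (walk_pmf G p n) = walk_pmf G p n"
proof (induction n)
  case (Suc n)
  then show ?case
    using assms by (simp add: map_inv_conv_pmf set_walk_pmf flip: walk_pmf_Suc_right)
qed simp

end

section \<open>The test as a random walk\<close>

lemma signed_simps [simp]: "signed G Positive b = b" "signed G Negative b = inv\<^bsub>G\<^esub> b"
  by (simp_all add: signed_def)

lemma signed_sum_Nil [simp]: "signed_sum G [] [] = \<one>\<^bsub>G\<^esub>"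
  by (simp add: signed_sum_def)

lemma signed_sum_Cons [simp]:
  "signed_sum G (s # ss) (b # bs) = signed G s b \<otimes>\<^bsub>G\<^esub> signed_sum G ss bs"
  by (simp add: signed_sum_def)

lemma (in group) signed_closed: "b \<in> carrier G \<Longrightarrow> signed G s b \<in> carrier G"
  by (cases s) auto

lemma UNIV_sign: "(UNIV :: sign set) = {Positive, Negative}"
  using sign.exhaust by auto

abbreviation flip_sign :: "sign \<Rightarrow> sign" where
  "flip_sign s \<equiv> (case s of Positive \<Rightarrow> Negative | Negative \<Rightarrow> Positive)"

lemma map_flip_sign: "map_pmf flip_sign (pmf_of_set UNIV) = pmf_of_set UNIV"
  by (rule map_pmf_of_set_bij_betw)
    (auto simp: bij_betw_def inj_on_def UNIV_sign image_def split: sign.splits)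

lemma (in group) inv_signed: "b \<in> carrier G \<Longrightarrow> inv (signed G s b) = signed G (flip_sign s) b"
  by (cases s) auto

section \<open>The uniform law on a finite group\<close>

abbreviation uniform_pmf :: "('a, 'm) monoid_scheme \<Rightarrow> 'a pmf" where
  "uniform_pmf G \<equiv> pmf_of_set (carrier G)"

locale finite_group = group +
  assumes finite_carrier: "finite (carrier G)"
begin

lemma carrier_nonempty: "carrier G \<noteq> {}"
  using one_closed by blast

lemma set_uniform [simp]: "set_pmf (uniform_pmf G) = carrier G"
  using carrier_nonempty finite_carrier by simp

lemma map_uniform:
  assumes "inj_on \<phi> (carrier G)" "\<phi> \<in> carrier G \<rightarrow> carrier G"
  shows "map_pmf \<phi> (uniform_pmf G) = uniform_pmf G"
proof -
  have "\<phi> ` carrier G = carrier G"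
    using assms finite_carrier by (intro card_subset_eq) (auto simp: card_image)
  then show ?thesis
    using assms carrier_nonempty finite_carrier by (simp add: map_pmf_of_set_inj)
qed

lemma map_mult_left_uniform: "a \<in> carrier G \<Longrightarrow> map_pmf (\<lambda>x. a \<otimes> x) (uniform_pmf G) = uniform_pmf G"
  by (rule map_uniform) (auto simp: inj_on_def)

lemma map_mult_right_uniform: "a \<in> carrier G \<Longrightarrow> map_pmf (\<lambda>x. x \<otimes> a) (uniform_pmf G) = uniform_pmf G"
  by (rule map_uniform) (auto simp: inj_on_def)

lemma map_signed_uniform: "map_pmf (signed G s) (uniform_pmf G) = uniform_pmf G"
proof (rule map_uniform)
  show "inj_on (signed G s) (carrier G)"
    by (cases s) (auto simp: inj_on_def dest: inv_inj[THEN inj_onD])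
qed (auto simp: signed_closed)

text \<open>Given the value of the second factor, the first is only translated, and translations
  preserve the uniform law.\<close>

lemma conv_uniform_left:
  assumes "set_pmf p \<subseteq> carrier G"
  shows "conv_pmf G (uniform_pmf G) p = uniform_pmf G"
proof -
  have "conv_pmf G (uniform_pmf G) p = bind_pmf p (\<lambda>b. map_pmf (\<lambda>a. a \<otimes> b) (uniform_pmf G))"
    unfolding conv_pmf_bind by (subst bind_commute_pmf) (simp add: map_pmf_def)
  also have "\<dots> = bind_pmf p (\<lambda>_. uniform_pmf G)"
    using assms by (intro bind_pmf_cong) (auto simp: map_mult_right_uniform)
  finally show ?thesis by simp
qed

end

section \<open>The joint walk of points and values\<close>

locale finite_group_map = G: finite_group G + H: group H
  for G :: "('a, 'm) monoid_scheme" and H :: "('b, 'n) monoid_scheme" +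
  fixes f :: "'a \<Rightarrow> 'b"
  assumes f_closed [intro, simp]: "x \<in> carrier G \<Longrightarrow> f x \<in> carrier H"
begin

sublocale GH: group "G \<times>\<times> H"
  by (intro DirProd_group G.group_axioms H.group_axioms)

text \<open>One sign acts on both the point and its value, so a single walk on the direct product
  carries both signed sums.\<close>

definition step :: "('a \<times> 'b) pmf" where
  "step = map_pmf (\<lambda>(s, x). (signed G s x, signed H s (f x))) (pair_pmf (pmf_of_set UNIV) (uniform_pmf G))"

abbreviation walk :: "nat \<Rightarrow> ('a \<times> 'b) pmf" where
  "walk n \<equiv> walk_pmf (G \<times>\<times> H) step n"

lemma set_step: "set_pmf step \<subseteq> carrier (G \<times>\<times> H)"
  by (auto simp: step_def G.signed_closed H.signed_closed)

lemma set_walk: "set_pmf (walk n) \<subseteq> carrier G \<times> carrier H"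
  using GH.set_walk_pmf[OF set_step] by simp

lemma step_closed:
  assumes "(a, b) \<in> set_pmf step"
  shows "a \<in> carrier G \<and> b \<in> carrier H"
  using assms set_step by auto

lemma walk_closed:
  assumes "(a, b) \<in> set_pmf (walk n)"
  shows "a \<in> carrier G \<and> b \<in> carrier H"
  using assms set_walk by auto

text \<open>Inverting a step flips its sign, and a flipped uniform sign is uniform.\<close>

lemma map_inv_step: "map_pmf (m_inv (G \<times>\<times> H)) step = step"
proof -
  have "map_pmf (m_inv (G \<times>\<times> H)) step = map_pmf (\<lambda>(s, x). (signed G s x, signed H s (f x)))
      (map_pmf (\<lambda>(s, x). (flip_sign s, x)) (pair_pmf (pmf_of_set UNIV) (uniform_pmf G)))"
    unfolding step_def map_pmf_comp
    by (rule map_pmf_cong)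
      (auto simp: G.signed_closed H.signed_closed G.inv_signed H.inv_signed
        inv_DirProd[OF G.group_axioms H.group_axioms])
  also have "map_pmf (\<lambda>(s, x). (flip_sign s, x)) (pair_pmf (pmf_of_set UNIV) (uniform_pmf G)) =
      pair_pmf (pmf_of_set UNIV) (uniform_pmf G)"
    using map_pair[of flip_sign "\<lambda>x. x" "pmf_of_set UNIV" "uniform_pmf G"]
    by (simp add: map_flip_sign)
  finally show ?thesis by (simp add: step_def)
qed

lemma map_inv_walk: "map_pmf (m_inv (G \<times>\<times> H)) (walk n) = walk n"
  by (rule GH.map_inv_walk_pmf[OF set_step map_inv_step])

lemma map_fst_conv: "map_pmf fst (conv_pmf (G \<times>\<times> H) p q) = conv_pmf G (map_pmf fst p) (map_pmf fst q)"
  by (simp add: conv_pmf_bind map_bind_pmf bind_map_pmf mult_DirProd')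

lemma map_fst_step: "map_pmf fst step = uniform_pmf G"
proof -
  have "map_pmf fst step = bind_pmf (pmf_of_set UNIV) (\<lambda>s. map_pmf (signed G s) (uniform_pmf G))"
    by (simp add: step_def pair_pmf_def map_bind_pmf map_pmf_def bind_assoc_pmf bind_return_pmf)
  then show ?thesis by (simp add: G.map_signed_uniform)
qed

text \<open>The first step is uniform on \<open>G\<close> and absorbs all later ones; length 0 is
  excluded because that walk sits at the identity.\<close>

lemma map_fst_walk:
  assumes "n > 0"
  shows "map_pmf fst (walk n) = uniform_pmf G"
proof -
  from assms obtain m where "n = Suc m" by (cases n) auto
  moreover have "set_pmf (map_pmf fst (walk m)) \<subseteq> carrier G"
    using set_walk by fastforce
  ultimately show ?thesis
    by (simp add: map_fst_conv map_fst_step G.conv_uniform_left)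
qed

text \<open>The test draws all points before all signs; independence allows regrouping the draws
  into pairs of one sign and one point, which are the steps.\<close>

lemma signed_sums_walk:
  "do {xs \<leftarrow> replicate_pmf n (uniform_pmf G);
       ss \<leftarrow> replicate_pmf n (pmf_of_set (UNIV :: sign set));
       return_pmf (signed_sum G ss xs, signed_sum H ss (map f xs))} = walk n"
proof (induction n)
  case (Suc n)
  have "do {xs \<leftarrow> replicate_pmf (Suc n) (uniform_pmf G);
       ss \<leftarrow> replicate_pmf (Suc n) (pmf_of_set (UNIV :: sign set));
       return_pmf (signed_sum G ss xs, signed_sum H ss (map f xs))} =
     do {x \<leftarrow> uniform_pmf G; xs \<leftarrow> replicate_pmf n (uniform_pmf G);
       s \<leftarrow> pmf_of_set (UNIV :: sign set); ss \<leftarrow> replicate_pmf n (pmf_of_set (UNIV :: sign set));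
       return_pmf (signed G s x \<otimes>\<^bsub>G\<^esub> signed_sum G ss xs,
         signed H s (f x) \<otimes>\<^bsub>H\<^esub> signed_sum H ss (map f xs))}"
    by (simp add: bind_assoc_pmf bind_return_pmf)
  also have "\<dots> = do {x \<leftarrow> uniform_pmf G; s \<leftarrow> pmf_of_set (UNIV :: sign set);
       xs \<leftarrow> replicate_pmf n (uniform_pmf G); ss \<leftarrow> replicate_pmf n (pmf_of_set (UNIV :: sign set));
       return_pmf (signed G s x \<otimes>\<^bsub>G\<^esub> signed_sum G ss xs,
         signed H s (f x) \<otimes>\<^bsub>H\<^esub> signed_sum H ss (map f xs))}"
    by (intro bind_pmf_cong refl bind_commute_pmf)
  also have "\<dots> = do {s \<leftarrow> pmf_of_set (UNIV :: sign set); x \<leftarrow> uniform_pmf G;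
       xs \<leftarrow> replicate_pmf n (uniform_pmf G); ss \<leftarrow> replicate_pmf n (pmf_of_set (UNIV :: sign set));
       return_pmf (signed G s x \<otimes>\<^bsub>G\<^esub> signed_sum G ss xs,
         signed H s (f x) \<otimes>\<^bsub>H\<^esub> signed_sum H ss (map f xs))}"
    by (rule bind_commute_pmf)
  also have "\<dots> = walk (Suc n)"
    unfolding walk_pmf.simps conv_pmf_bind Suc.IH[symmetric]
    by (simp add: step_def pair_pmf_def map_pmf_def bind_assoc_pmf bind_return_pmf)
  finally show ?case .
qed (simp add: bind_return_pmf)

lemma random_signs_test_walk:
  "random_signs_test G H n f =
     map_pmf (\<lambda>(a, b). if b = f a then Accept else Reject) (walk n)"
  by (simp add: random_signs_test_def Let_def map_bind_pmf flip: signed_sums_walk)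

lemma prob_reject:
  "measure_pmf.prob (random_signs_test G H n f) {Reject} =
     measure_pmf.prob (walk n) {(a, b). b \<noteq> f a}"
proof -
  have "(\<lambda>(a, b). if b = f a then Accept else Reject) -` {Reject} = {(a, b). b \<noteq> f a}"
    by auto
  then show ?thesis by (simp add: random_signs_test_walk)
qed

text \<open>A walk of length 2 k is a product of two independent walks of length k;
  \<open>defect_le\<close> works with such pairs.\<close>

lemma prob_reject_double:
  "measure_pmf.prob (random_signs_test G H (2 * k) f) {Reject} =
     measure_pmf.prob (pair_pmf (walk k) (walk k))
       {((a, b), (a', b')). b \<otimes>\<^bsub>H\<^esub> b' \<noteq> f (a \<otimes>\<^bsub>G\<^esub> a')}"
  unfolding prob_reject mult_2 GH.walk_pmf_add[OF set_step] conv_pmf_def measure_map_pmf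
  by (rule arg_cong[where f = "measure_pmf.prob _"]) auto

section \<open>From the test to a nearby homomorphism\<close>

text \<open>The rejection probability of the Blum-Luby-Rubinfeld homomorphism test.\<close>

definition defect :: real where
  "defect = measure_pmf.prob (pair_pmf (uniform_pmf G) (uniform_pmf G))
     {(x, y). f (x \<otimes>\<^bsub>G\<^esub> y) \<noteq> f x \<otimes>\<^bsub>H\<^esub> f y}"

lemma defect_le:
  assumes "n > 0"
  shows "defect \<le> 3 * measure_pmf.prob (pair_pmf (walk n) (walk n))
       {((a, b), (a', b')). b \<otimes>\<^bsub>H\<^esub> b' \<noteq> f (a \<otimes>\<^bsub>G\<^esub> a')}"
proof -
  let ?W = "walk n" and ?U = "uniform_pmf G"
  let ?B = "{((a, b), (a', b')). b \<otimes>\<^bsub>H\<^esub> b' \<noteq> f (a \<otimes>\<^bsub>G\<^esub> a')}"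
  \<comment> \<open>The shared walk v comes first, so that conditioning on it leaves u and w
    independent.\<close>
  let ?J = "pair_pmf ?W (pair_pmf ?W ?W)"
  have right: "map_pmf (\<lambda>u. fst u \<otimes>\<^bsub>G\<^esub> a) ?W = ?U" if "a \<in> carrier G" for a
    using G.map_mult_right_uniform[OF that] unfolding map_fst_walk[OF assms, symmetric]
    by (simp add: map_pmf_comp)
  have left: "map_pmf (\<lambda>w. a \<otimes>\<^bsub>G\<^esub> fst w) ?W = ?U" if "a \<in> carrier G" for a
    using G.map_mult_left_uniform[OF that] unfolding map_fst_walk[OF assms, symmetric]
    by (simp add: map_pmf_comp)
  have fst_closed: "fst v \<in> carrier G" if "v \<in> set_pmf ?W" for v
    using that set_walk by fastforce
  \<comment> \<open>For every fixed v the two points are translates of independent uniform points,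
    so they remain independent and uniform.\<close>
  have "map_pmf (\<lambda>(v, u, w). (fst u \<otimes>\<^bsub>G\<^esub> fst v, inv\<^bsub>G\<^esub> fst v \<otimes>\<^bsub>G\<^esub> fst w)) ?J =
      bind_pmf ?W (\<lambda>v. pair_pmf (map_pmf (\<lambda>u. fst u \<otimes>\<^bsub>G\<^esub> fst v) ?W)
        (map_pmf (\<lambda>w. inv\<^bsub>G\<^esub> fst v \<otimes>\<^bsub>G\<^esub> fst w) ?W))"
    by (simp add: pair_pmf_def map_pmf_def bind_assoc_pmf bind_return_pmf)
  also have "\<dots> = bind_pmf ?W (\<lambda>v. pair_pmf ?U ?U)"
    by (intro bind_pmf_cong refl) (simp add: left right fst_closed)
  finally have "pair_pmf ?U ?U =
      map_pmf (\<lambda>(v, u, w). (fst u \<otimes>\<^bsub>G\<^esub> fst v, inv\<^bsub>G\<^esub> fst v \<otimes>\<^bsub>G\<^esub> fst w)) ?J"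
    by simp
  then have "defect = measure_pmf.prob ?J
      {(v, u, w). f ((fst u \<otimes>\<^bsub>G\<^esub> fst v) \<otimes>\<^bsub>G\<^esub> (inv\<^bsub>G\<^esub> fst v \<otimes>\<^bsub>G\<^esub> fst w)) \<noteq>
        f (fst u \<otimes>\<^bsub>G\<^esub> fst v) \<otimes>\<^bsub>H\<^esub> f (inv\<^bsub>G\<^esub> fst v \<otimes>\<^bsub>G\<^esub> fst w)}" (is "_ = measure _ ?A")
    by (simp add: defect_def vimage_def case_prod_unfold)
  also have "\<dots> \<le> measure_pmf.prob ?J {(v, u, w). (u, v) \<in> ?B}
      + measure_pmf.prob ?J ({(v, u, w). (inv\<^bsub>G \<times>\<times> H\<^esub> v, w) \<in> ?B} \<union> {(v, u, w). (u, w) \<in> ?B})"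
  proof (rule prob_le_add)
    fix t assume t: "t \<in> set_pmf ?J" "t \<in> ?A"
    obtain av bv au bu aw bw where t_eq: "t = ((av, bv), (au, bu), (aw, bw))"
      by (metis prod.collapse)
    have [simp]: "av \<in> carrier G" "au \<in> carrier G" "aw \<in> carrier G"
        "bv \<in> carrier H" "bu \<in> carrier H" "bw \<in> carrier H"
      using t set_walk by (auto simp: t_eq)
    have inv_eq: "inv\<^bsub>G \<times>\<times> H\<^esub> (av, bv) = (inv\<^bsub>G\<^esub> av, inv\<^bsub>H\<^esub> bv)"
      by (simp add: inv_DirProd[OF G.group_axioms H.group_axioms])
    show "t \<in> {(v, u, w). (u, v) \<in> ?B} \<union>
        ({(v, u, w). (inv\<^bsub>G \<times>\<times> H\<^esub> v, w) \<in> ?B} \<union> {(v, u, w). (u, w) \<in> ?B})"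
    \<comment> \<open>If \<open>f\<close> is predicted correctly at all three points, v cancels in
      both groups and multiplicativity holds.\<close>
    proof (rule ccontr)
      assume "\<not> ?thesis"
      then have "f (au \<otimes>\<^bsub>G\<^esub> av) = bu \<otimes>\<^bsub>H\<^esub> bv" "f (inv\<^bsub>G\<^esub> av \<otimes>\<^bsub>G\<^esub> aw) = inv\<^bsub>H\<^esub> bv \<otimes>\<^bsub>H\<^esub> bw"
          "f (au \<otimes>\<^bsub>G\<^esub> aw) = bu \<otimes>\<^bsub>H\<^esub> bw"
        by (simp_all add: t_eq inv_eq)
      moreover have "(au \<otimes>\<^bsub>G\<^esub> av) \<otimes>\<^bsub>G\<^esub> (inv\<^bsub>G\<^esub> av \<otimes>\<^bsub>G\<^esub> aw) = au \<otimes>\<^bsub>G\<^esub> aw"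
        by (simp add: G.m_assoc G.mult_inv_cancel_left)
      moreover have "(bu \<otimes>\<^bsub>H\<^esub> bv) \<otimes>\<^bsub>H\<^esub> (inv\<^bsub>H\<^esub> bv \<otimes>\<^bsub>H\<^esub> bw) = bu \<otimes>\<^bsub>H\<^esub> bw"
        by (simp add: H.m_assoc H.mult_inv_cancel_left)
      ultimately show False using t(2) by (simp add: t_eq)
    qed
  qed
  also have "\<dots> \<le> measure_pmf.prob ?J {(v, u, w). (u, v) \<in> ?B}
      + (measure_pmf.prob ?J {(v, u, w). (inv\<^bsub>G \<times>\<times> H\<^esub> v, w) \<in> ?B}
      + measure_pmf.prob ?J {(v, u, w). (u, w) \<in> ?B})"
    by (intro add_left_mono prob_le_add) auto
  also have "measure_pmf.prob ?J {(v, u, w). (u, v) \<in> ?B} = measure_pmf.prob (pair_pmf ?W ?W) ?B"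
  proof -
    have "map_pmf (\<lambda>(v, u, w). (u, v)) ?J = bind_pmf ?W (\<lambda>v. bind_pmf ?W (\<lambda>u. return_pmf (u, v)))"
      by (simp add: pair_pmf_def map_pmf_def bind_assoc_pmf bind_return_pmf)
    also have "\<dots> = pair_pmf ?W ?W"
      unfolding pair_pmf_def by (rule bind_commute_pmf)
    finally show ?thesis by (rule prob_map_pmf_eq) auto
  qed
  also have "measure_pmf.prob ?J {(v, u, w). (inv\<^bsub>G \<times>\<times> H\<^esub> v, w) \<in> ?B} =
      measure_pmf.prob (pair_pmf ?W ?W) ?B"
  proof -
    have "map_pmf (\<lambda>(v, u, w). (inv\<^bsub>G \<times>\<times> H\<^esub> v, w)) ?J = pair_pmf (map_pmf (m_inv (G \<times>\<times> H)) ?W) ?W"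
      by (simp add: pair_pmf_def map_pmf_def bind_assoc_pmf bind_return_pmf)
    then have "map_pmf (\<lambda>(v, u, w). (inv\<^bsub>G \<times>\<times> H\<^esub> v, w)) ?J = pair_pmf ?W ?W"
      by (simp add: map_inv_walk)
    then show ?thesis by (rule prob_map_pmf_eq) auto
  qed
  also have "measure_pmf.prob ?J {(v, u, w). (u, w) \<in> ?B} = measure_pmf.prob (pair_pmf ?W ?W) ?B"
  proof -
    have "map_pmf (\<lambda>(v, u, w). (u, w)) ?J = pair_pmf ?W ?W"
      by (simp add: pair_pmf_def map_pmf_def bind_assoc_pmf bind_return_pmf)
    then show ?thesis by (rule prob_map_pmf_eq) auto
  qed
  finally show ?thesis by simp
qed

text \<open>Each y votes for a value of the homomorphism at x. Two independent votes agree with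
  probability at least 1 - 2 \<open>defect\<close> > 5/8, which forces a value of mass above
  3/4.\<close>

lemma ex_popular_value:
  assumes "defect < 3/16" "x \<in> carrier G"
  shows "\<exists>h. measure_pmf.prob (uniform_pmf G) {y. f (x \<otimes>\<^bsub>G\<^esub> y) \<otimes>\<^bsub>H\<^esub> inv\<^bsub>H\<^esub> f y \<noteq> h} < 1/4"
proof (rule ccontr)
  let ?U = "uniform_pmf G"
  let ?F = "\<lambda>y. f (x \<otimes>\<^bsub>G\<^esub> y) \<otimes>\<^bsub>H\<^esub> inv\<^bsub>H\<^esub> f y"
  let ?p = "map_pmf ?F ?U"
  assume none: "\<not> ?thesis"
  have "pmf ?p h \<le> 3/4" for h
  proof -
    have "measure_pmf.prob ?U {y. ?F y \<noteq> h} = 1 - pmf ?p h"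
      using measure_pmf.prob_compl[of "{y. ?F y = h}" ?U]
      by (simp add: pmf_map vimage_def Compl_eq_Diff_UNIV[symmetric] Collect_neg_eq)
    moreover have "\<not> measure_pmf.prob ?U {y. ?F y \<noteq> h} < 1/4"
      using none by blast
    ultimately show ?thesis by linarith
  qed
  \<comment> \<open>With M = N = 3/4 the bound is 1/2 + (1/2)(1/2)/2 = 5/8.\<close>
  from collision_le[OF this this]
  have le: "measure_pmf.prob (pair_pmf ?p ?p) {(x, y). x = y} \<le> 5/8" by simp
  \<comment> \<open>The second voter is written as y t with t uniform; the votes of y and y t agree
    once \<open>f\<close> is multiplicative at (y, t) and at (x y, t).\<close>
  have "map_pmf (\<lambda>(y, t). (y, y \<otimes>\<^bsub>G\<^esub> t)) (pair_pmf ?U ?U) =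
      bind_pmf ?U (\<lambda>y. map_pmf (Pair y) (map_pmf (\<lambda>t. y \<otimes>\<^bsub>G\<^esub> t) ?U))"
    by (simp add: pair_pmf_def map_pmf_def bind_assoc_pmf bind_return_pmf)
  also have "\<dots> = bind_pmf ?U (\<lambda>y. map_pmf (Pair y) ?U)"
    by (intro bind_pmf_cong refl) (simp add: G.map_mult_left_uniform)
  also have "\<dots> = pair_pmf ?U ?U"
    by (simp add: pair_pmf_def map_pmf_def)
  finally have "pair_pmf ?p ?p =
      map_pmf (\<lambda>(a, b). (?F a, ?F b)) (map_pmf (\<lambda>(y, t). (y, y \<otimes>\<^bsub>G\<^esub> t)) (pair_pmf ?U ?U))"
    by (simp add: map_pair)
  then have eq: "pair_pmf ?p ?p = map_pmf (\<lambda>(y, t). (?F y, ?F (y \<otimes>\<^bsub>G\<^esub> t))) (pair_pmf ?U ?U)"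
    by (simp add: map_pmf_comp case_prod_unfold)
  have "1 - measure_pmf.prob (pair_pmf ?p ?p) {(x, y). x = y} =
      measure_pmf.prob (pair_pmf ?p ?p) (- {(x, y). x = y})"
    using measure_pmf.prob_compl[of "{(x, y). x = y}" "pair_pmf ?p ?p"]
    by (simp add: Compl_eq_Diff_UNIV)
  also have "\<dots> = measure_pmf.prob (pair_pmf ?U ?U) {(y, t). ?F y \<noteq> ?F (y \<otimes>\<^bsub>G\<^esub> t)}"
    unfolding eq measure_map_pmf by (rule arg_cong[where f = "measure_pmf.prob _"]) auto
  also have "\<dots> \<le> measure_pmf.prob (pair_pmf ?U ?U) {(y, t). f (y \<otimes>\<^bsub>G\<^esub> t) \<noteq> f y \<otimes>\<^bsub>H\<^esub> f t}
      + measure_pmf.prob (pair_pmf ?U ?U)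
          {(y, t). f ((x \<otimes>\<^bsub>G\<^esub> y) \<otimes>\<^bsub>G\<^esub> t) \<noteq> f (x \<otimes>\<^bsub>G\<^esub> y) \<otimes>\<^bsub>H\<^esub> f t}"
  proof (rule prob_le_add, rule ccontr)
    fix z assume z: "z \<in> set_pmf (pair_pmf ?U ?U)" "z \<in> {(y, t). ?F y \<noteq> ?F (y \<otimes>\<^bsub>G\<^esub> t)}"
      "z \<notin> {(y, t). f (y \<otimes>\<^bsub>G\<^esub> t) \<noteq> f y \<otimes>\<^bsub>H\<^esub> f t} \<union>
        {(y, t). f ((x \<otimes>\<^bsub>G\<^esub> y) \<otimes>\<^bsub>G\<^esub> t) \<noteq> f (x \<otimes>\<^bsub>G\<^esub> y) \<otimes>\<^bsub>H\<^esub> f t}"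
    obtain y t where z_eq: "z = (y, t)" by (cases z)
    have [simp]: "y \<in> carrier G" "t \<in> carrier G" using z by (auto simp: z_eq)
    have "f (x \<otimes>\<^bsub>G\<^esub> (y \<otimes>\<^bsub>G\<^esub> t)) = f (x \<otimes>\<^bsub>G\<^esub> y) \<otimes>\<^bsub>H\<^esub> f t" "f (y \<otimes>\<^bsub>G\<^esub> t) = f y \<otimes>\<^bsub>H\<^esub> f t"
      using z(3) assms(2) by (auto simp: z_eq G.m_assoc)
    then have "?F (y \<otimes>\<^bsub>G\<^esub> t) = ?F y"
      using assms(2) by (simp add: H.inv_mult_group H.m_assoc H.mult_inv_cancel_left)
    with z(2) show False by (simp add: z_eq)
  qed
  also have "measure_pmf.prob (pair_pmf ?U ?U)
      {(y, t). f ((x \<otimes>\<^bsub>G\<^esub> y) \<otimes>\<^bsub>G\<^esub> t) \<noteq> f (x \<otimes>\<^bsub>G\<^esub> y) \<otimes>\<^bsub>H\<^esub> f t} = defect"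
  proof -
    have "map_pmf (\<lambda>(y, t). (x \<otimes>\<^bsub>G\<^esub> y, t)) (pair_pmf ?U ?U) = pair_pmf ?U ?U"
      using map_pair[of "\<lambda>y. x \<otimes>\<^bsub>G\<^esub> y" "\<lambda>t. t" ?U ?U] assms(2)
      by (simp add: G.map_mult_left_uniform)
    then show ?thesis
      unfolding defect_def by (rule prob_map_pmf_eq) auto
  qed
  finally show False
    using le assms(1) by (simp add: defect_def)
qed

text \<open>Plurality decoding: \<open>g x\<close> is the popular vote at x. If
  \<open>f x \<noteq> g x\<close>, then every y voting for \<open>g x\<close> violates
  multiplicativity at (x, y), and these y have probability above 3/4.\<close>

lemma ex_close_hom:
  assumes "defect < 3/16"
  obtains g where "g \<in> hom G H" "3/4 * measure_pmf.prob (uniform_pmf G) {x. f x \<noteq> g x} \<le> defect"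
proof -
  let ?U = "uniform_pmf G"
  let ?F = "\<lambda>x y. f (x \<otimes>\<^bsub>G\<^esub> y) \<otimes>\<^bsub>H\<^esub> inv\<^bsub>H\<^esub> f y"
  obtain g where g: "\<And>x. x \<in> carrier G \<Longrightarrow> measure_pmf.prob ?U {y. ?F x y \<noteq> g x} < 1/4"
    using ex_popular_value[OF assms] by metis
  have closed: "g x \<in> carrier H" if x: "x \<in> carrier G" for x
  proof -
    \<comment> \<open>Empty events pad the list to the three that \<open>ex_not_in_3\<close>
      expects.\<close>
    have "measure_pmf.prob ?U {y. ?F x y \<noteq> g x} + measure_pmf.prob ?U {} + measure_pmf.prob ?U {} < 1"
      using g[OF x] by simp
    then obtain y where "y \<in> set_pmf ?U" "y \<notin> {y. ?F x y \<noteq> g x}"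
      by (rule ex_not_in_3)
    then have "y \<in> carrier G" "g x = ?F x y" by auto
    with x show ?thesis by simp
  qed
  have "g (x \<otimes>\<^bsub>G\<^esub> y) = g x \<otimes>\<^bsub>H\<^esub> g y" if x: "x \<in> carrier G" and y: "y \<in> carrier G" for x y
  proof -
    \<comment> \<open>Since y w is uniform, some w makes all three votes popular: y w at x, w at y
      and w at x y. The product of the first two votes then telescopes to the third.\<close>
    have "measure_pmf.prob ?U {w. ?F x (y \<otimes>\<^bsub>G\<^esub> w) \<noteq> g x} =
        measure_pmf.prob (map_pmf (\<lambda>w. y \<otimes>\<^bsub>G\<^esub> w) ?U) {w. ?F x w \<noteq> g x}"
      by (simp add: vimage_def)
    then have "measure_pmf.prob ?U {w. ?F x (y \<otimes>\<^bsub>G\<^esub> w) \<noteq> g x} + measure_pmf.prob ?U {w. ?F y w \<noteq> g y}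
        + measure_pmf.prob ?U {w. ?F (x \<otimes>\<^bsub>G\<^esub> y) w \<noteq> g (x \<otimes>\<^bsub>G\<^esub> y)} < 1"
      using g[OF x] g[OF y] g[of "x \<otimes>\<^bsub>G\<^esub> y"] x y by (simp add: G.map_mult_left_uniform)
    then obtain w where "w \<in> set_pmf ?U" "w \<notin> {w. ?F x (y \<otimes>\<^bsub>G\<^esub> w) \<noteq> g x}"
        "w \<notin> {w. ?F y w \<noteq> g y}" "w \<notin> {w. ?F (x \<otimes>\<^bsub>G\<^esub> y) w \<noteq> g (x \<otimes>\<^bsub>G\<^esub> y)}"
      by (rule ex_not_in_3)
    then have w: "w \<in> carrier G" "g x = ?F x (y \<otimes>\<^bsub>G\<^esub> w)" "g y = ?F y w"
        "g (x \<otimes>\<^bsub>G\<^esub> y) = ?F (x \<otimes>\<^bsub>G\<^esub> y) w"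
      by simp_all
    then show ?thesis
      using x y
      by (simp add: G.m_assoc H.m_assoc H.mult_inv_cancel_left)
  qed
  with closed have hom: "g \<in> hom G H" by (auto simp: hom_def)
  have "3/4 * measure_pmf.prob ?U {x. f x \<noteq> g x} =
      measure_pmf.expectation ?U (\<lambda>x. 3/4 * indicator {x. f x \<noteq> g x} x)"
    by simp
  also have "\<dots> \<le> measure_pmf.expectation ?U
      (\<lambda>x. measure_pmf.prob ?U {y. f (x \<otimes>\<^bsub>G\<^esub> y) \<noteq> f x \<otimes>\<^bsub>H\<^esub> f y})"
  proof (rule integral_mono_AE)
    show "AE x in ?U. 3/4 * indicator {x. f x \<noteq> g x} x \<le>
        measure_pmf.prob ?U {y. f (x \<otimes>\<^bsub>G\<^esub> y) \<noteq> f x \<otimes>\<^bsub>H\<^esub> f y}"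
    proof (unfold AE_measure_pmf_iff, intro ballI)
      fix x assume "x \<in> set_pmf ?U"
      then have x: "x \<in> carrier G" by simp
      show "3/4 * indicator {x. f x \<noteq> g x} x \<le>
        measure_pmf.prob ?U {y. f (x \<otimes>\<^bsub>G\<^esub> y) \<noteq> f x \<otimes>\<^bsub>H\<^esub> f y}"
      proof (cases "f x = g x")
        case False
        have "measure_pmf.prob ?U UNIV \<le> measure_pmf.prob ?U {y. ?F x y \<noteq> g x} +
            measure_pmf.prob ?U {y. f (x \<otimes>\<^bsub>G\<^esub> y) \<noteq> f x \<otimes>\<^bsub>H\<^esub> f y}"
          by (rule prob_le_add) (use x False in \<open>auto simp: H.m_assoc\<close>)
        with g[OF x] False show ?thesis by simp
      qed simp
    qed
  qed (auto intro!: measure_pmf.integrable_const_bound[where B = 1])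
  also have "\<dots> = defect"
    by (simp add: defect_def prob_pair_pmf)
  finally show thesis using hom that by blast
qed

section \<open>Errors relative to a nearby homomorphism\<close>

definition distance :: "('a \<Rightarrow> 'b) \<Rightarrow> real" where
  "distance g = measure_pmf.prob (uniform_pmf G) {x. f x \<noteq> g x}"

text \<open>\<open>G\<close> acts on \<open>H\<close> through conjugation by \<open>g x\<close>. The
  set of x carrying v to u is empty or a coset of the stabilizer of v; it misses y, so it fills at
  most half of \<open>G\<close>.\<close>

lemma prob_twisted_fixed_le:
  assumes hom: "g \<in> hom G H" and u: "u \<in> carrier H" and v: "v \<in> carrier H"
    and y: "y \<in> carrier G" "g y \<otimes>\<^bsub>H\<^esub> v \<noteq> u \<otimes>\<^bsub>H\<^esub> g y"
  shows "measure_pmf.prob (uniform_pmf G) {x. g x \<otimes>\<^bsub>H\<^esub> v = u \<otimes>\<^bsub>H\<^esub> g x} \<le> 1/2"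
proof (cases "\<exists>s \<in> carrier G. g s \<otimes>\<^bsub>H\<^esub> v = u \<otimes>\<^bsub>H\<^esub> g s")
  case False
  then have "measure_pmf.prob (uniform_pmf G) {x. g x \<otimes>\<^bsub>H\<^esub> v = u \<otimes>\<^bsub>H\<^esub> g x} = 0"
    by (auto simp: measure_pmf_zero_iff disjoint_iff)
  then show ?thesis by simp
next
  case True
  let ?U = "uniform_pmf G" and ?S = "{x. g x \<otimes>\<^bsub>H\<^esub> v = u \<otimes>\<^bsub>H\<^esub> g x}"
  interpret g: group_hom G H g
    by unfold_locales (rule hom)
  from True obtain s where s: "s \<in> carrier G" "g s \<otimes>\<^bsub>H\<^esub> v = u \<otimes>\<^bsub>H\<^esub> g s" by blast
  \<comment> \<open>Left multiplication by z takes the member s of \<open>?S\<close> to the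
    non-member y.\<close>
  define z where "z = y \<otimes>\<^bsub>G\<^esub> inv\<^bsub>G\<^esub> s"
  have z: "z \<in> carrier G" using y s by (simp add: z_def)
  \<comment> \<open>Translation by \<open>z\<close> moves the coset \<open>?S\<close> off itself.\<close>
  have disj: "z \<otimes>\<^bsub>G\<^esub> t \<notin> ?S" if t: "t \<in> carrier G" "t \<in> ?S" for t
  proof
    assume "z \<otimes>\<^bsub>G\<^esub> t \<in> ?S"
    then have eq: "g y \<otimes>\<^bsub>H\<^esub> (inv\<^bsub>H\<^esub> g s \<otimes>\<^bsub>H\<^esub> (g t \<otimes>\<^bsub>H\<^esub> v)) = u \<otimes>\<^bsub>H\<^esub> (g y \<otimes>\<^bsub>H\<^esub> (inv\<^bsub>H\<^esub> g s \<otimes>\<^bsub>H\<^esub> g t))"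
      using y s t v u by (simp add: z_def H.m_assoc)
    have "inv\<^bsub>H\<^esub> g s \<otimes>\<^bsub>H\<^esub> u = v \<otimes>\<^bsub>H\<^esub> inv\<^bsub>H\<^esub> g s"
    proof -
      have "v = inv\<^bsub>H\<^esub> g s \<otimes>\<^bsub>H\<^esub> (u \<otimes>\<^bsub>H\<^esub> g s)"
        using s v by (simp add: H.mult_inv_cancel_left flip: s(2))
      then show ?thesis
        using s u by (simp add: H.m_assoc)
    qed
    moreover have "inv\<^bsub>H\<^esub> g s \<otimes>\<^bsub>H\<^esub> (g t \<otimes>\<^bsub>H\<^esub> v) = (inv\<^bsub>H\<^esub> g s \<otimes>\<^bsub>H\<^esub> u) \<otimes>\<^bsub>H\<^esub> g t"
      using t s u by (simp add: H.m_assoc)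
    ultimately have "(g y \<otimes>\<^bsub>H\<^esub> v) \<otimes>\<^bsub>H\<^esub> (inv\<^bsub>H\<^esub> g s \<otimes>\<^bsub>H\<^esub> g t) = (u \<otimes>\<^bsub>H\<^esub> g y) \<otimes>\<^bsub>H\<^esub> (inv\<^bsub>H\<^esub> g s \<otimes>\<^bsub>H\<^esub> g t)"
      using eq y s t u v by (simp add: H.m_assoc)
    then have "g y \<otimes>\<^bsub>H\<^esub> v = u \<otimes>\<^bsub>H\<^esub> g y"
      using y(1) s t u v by (simp add: H.right_cancel)
    with y show False by simp
  qed
  have "measure_pmf.prob ?U ?S = measure_pmf.prob ?U {x. z \<otimes>\<^bsub>G\<^esub> x \<in> ?S}"
    using prob_map_pmf_eq[OF G.map_mult_left_uniform[OF z], of "{x. z \<otimes>\<^bsub>G\<^esub> x \<in> ?S}" ?S]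
    by (simp add: vimage_def)
  also have "\<dots> \<le> measure_pmf.prob ?U (- ?S)"
    using disj by (intro prob_mono) auto
  also have "\<dots> = 1 - measure_pmf.prob ?U ?S"
    using measure_pmf.prob_compl[of ?S ?U] by (simp add: Compl_eq_Diff_UNIV)
  finally show ?thesis by simp
qed

text \<open>If \<open>g\<close> intertwines v and u everywhere, the equation forces
  \<open>f x = g x\<close>. Otherwise it forces \<open>f x \<noteq> g x\<close> or membership in a
  set of density at most 1/2, and 1/2 + \<open>distance g\<close> \<le> 1 -
  \<open>distance g\<close> exactly when \<open>distance g \<le> 1/4\<close>.\<close>

lemma prob_twisted_agree_le:
  assumes hom: "g \<in> hom G H" and small: "distance g \<le> 1/4"
    and u: "u \<in> carrier H" and v: "v \<in> carrier H"
  shows "measure_pmf.prob (uniform_pmf G) {x. u \<otimes>\<^bsub>H\<^esub> f x = g x \<otimes>\<^bsub>H\<^esub> v} \<le> 1 - distance g"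
proof (cases "\<forall>y \<in> carrier G. g y \<otimes>\<^bsub>H\<^esub> v = u \<otimes>\<^bsub>H\<^esub> g y")
  case True
  have "f x = g x" if "x \<in> carrier G" "u \<otimes>\<^bsub>H\<^esub> f x = g x \<otimes>\<^bsub>H\<^esub> v" for x
    using that True u hom_in_carrier[OF hom] by simp
  then have "measure_pmf.prob (uniform_pmf G) {x. u \<otimes>\<^bsub>H\<^esub> f x = g x \<otimes>\<^bsub>H\<^esub> v} \<le>
      measure_pmf.prob (uniform_pmf G) (- {x. f x \<noteq> g x})"
    by (intro prob_mono) auto
  also have "\<dots> = 1 - distance g"
    using measure_pmf.prob_compl[of "{x. f x \<noteq> g x}" "uniform_pmf G"]
    by (simp add: Compl_eq_Diff_UNIV distance_def)
  finally show ?thesis .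
next
  case False
  then have "measure_pmf.prob (uniform_pmf G) {x. g x \<otimes>\<^bsub>H\<^esub> v = u \<otimes>\<^bsub>H\<^esub> g x} \<le> 1/2"
    using prob_twisted_fixed_le[OF hom u v] by blast
  moreover have "measure_pmf.prob (uniform_pmf G) {x. u \<otimes>\<^bsub>H\<^esub> f x = g x \<otimes>\<^bsub>H\<^esub> v} \<le>
      measure_pmf.prob (uniform_pmf G) {x. g x \<otimes>\<^bsub>H\<^esub> v = u \<otimes>\<^bsub>H\<^esub> g x} + distance g"
    unfolding distance_def by (rule prob_le_add) auto
  ultimately show ?thesis using small by simp
qed

definition error_pmf :: "('a \<Rightarrow> 'b) \<Rightarrow> nat \<Rightarrow> 'b pmf" where
  "error_pmf g n = map_pmf (\<lambda>(a, b). inv\<^bsub>H\<^esub> g a \<otimes>\<^bsub>H\<^esub> b) (walk n)"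

text \<open>After appending a step (a, b), the error equals \<open>h\<close> iff the previous error
  was the value mapped here. This bounds the atoms of that target law, separately for each
  sign.\<close>

lemma pmf_twisted_step_le:
  assumes hom: "g \<in> hom G H" and small: "distance g \<le> 1/4" and h: "h \<in> carrier H"
  shows "pmf (map_pmf (\<lambda>(a, b). (g a \<otimes>\<^bsub>H\<^esub> h) \<otimes>\<^bsub>H\<^esub> inv\<^bsub>H\<^esub> b) step) h' \<le> 1 - distance g"
proof (cases "h' \<in> carrier H")
  case False
  interpret g: group_hom G H g
    by unfold_locales (rule hom)
  have "h' \<notin> set_pmf (map_pmf (\<lambda>(a, b). (g a \<otimes>\<^bsub>H\<^esub> h) \<otimes>\<^bsub>H\<^esub> inv\<^bsub>H\<^esub> b) step)"
    using False h by (auto dest!: step_closed)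
  then show ?thesis using small unfolding set_pmf_iff by simp
next
  case h': True
  interpret g: group_hom G H g
    by unfold_locales (rule hom)
  let ?U = "uniform_pmf G"
  have le: "measure_pmf.prob ?U {x. (g (signed G s x) \<otimes>\<^bsub>H\<^esub> h) \<otimes>\<^bsub>H\<^esub> inv\<^bsub>H\<^esub> signed H s (f x) = h'}
      \<le> 1 - distance g" for s
  proof (cases s)
    case Positive
    have "h' \<otimes>\<^bsub>H\<^esub> f x = g x \<otimes>\<^bsub>H\<^esub> h"
      if "x \<in> carrier G" "(g x \<otimes>\<^bsub>H\<^esub> h) \<otimes>\<^bsub>H\<^esub> inv\<^bsub>H\<^esub> f x = h'" for x
      using that h by (auto simp: H.m_assoc)
    then have "measure_pmf.prob ?U {x. (g x \<otimes>\<^bsub>H\<^esub> h) \<otimes>\<^bsub>H\<^esub> inv\<^bsub>H\<^esub> f x = h'} \<le>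
        measure_pmf.prob ?U {x. h' \<otimes>\<^bsub>H\<^esub> f x = g x \<otimes>\<^bsub>H\<^esub> h}"
      by (intro prob_mono) auto
    also have "\<dots> \<le> 1 - distance g"
      by (rule prob_twisted_agree_le[OF hom small h' h])
    finally show ?thesis by (simp add: Positive)
  next
    \<comment> \<open>Moving \<open>g x\<close> to the other side gives the same twisted equation
      with \<open>h\<close> and \<open>h'\<close> exchanged.\<close>
    case Negative
    have "h \<otimes>\<^bsub>H\<^esub> f x = g x \<otimes>\<^bsub>H\<^esub> h'"
      if "x \<in> carrier G" "(g (inv\<^bsub>G\<^esub> x) \<otimes>\<^bsub>H\<^esub> h) \<otimes>\<^bsub>H\<^esub> inv\<^bsub>H\<^esub> (inv\<^bsub>H\<^esub> f x) = h'" for x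
      using that h by (auto simp: H.m_assoc H.mult_inv_cancel_left)
    then have "measure_pmf.prob ?U {x. (g (inv\<^bsub>G\<^esub> x) \<otimes>\<^bsub>H\<^esub> h) \<otimes>\<^bsub>H\<^esub> inv\<^bsub>H\<^esub> (inv\<^bsub>H\<^esub> f x) = h'} \<le>
        measure_pmf.prob ?U {x. h \<otimes>\<^bsub>H\<^esub> f x = g x \<otimes>\<^bsub>H\<^esub> h'}"
      by (intro prob_mono) auto
    also have "\<dots> \<le> 1 - distance g"
      by (rule prob_twisted_agree_le[OF hom small h h'])
    finally show ?thesis by (simp add: Negative)
  qed
  have "pmf (map_pmf (\<lambda>(a, b). (g a \<otimes>\<^bsub>H\<^esub> h) \<otimes>\<^bsub>H\<^esub> inv\<^bsub>H\<^esub> b) step) h' =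
      measure_pmf.expectation (pmf_of_set UNIV) (\<lambda>s. measure_pmf.prob ?U
        {x. (g (signed G s x) \<otimes>\<^bsub>H\<^esub> h) \<otimes>\<^bsub>H\<^esub> inv\<^bsub>H\<^esub> signed H s (f x) = h'})"
    by (simp add: step_def map_pmf_comp pmf_map prob_pair_pmf vimage_def case_prod_unfold)
  also have "\<dots> \<le> measure_pmf.expectation (pmf_of_set (UNIV :: sign set)) (\<lambda>_. 1 - distance g)"
    by (intro integral_mono le) (auto intro!: measure_pmf.integrable_const_bound[where B = 1])
  finally show ?thesis by simp
qed

text \<open>Reaching \<open>h\<close> is a collision between the previous error and an independent
  target given by the last step, so \<open>collision_le\<close> multiplies the bias by 2 (1 -
  \<open>distance g\<close>) - 1 = 1 - 2 \<open>distance g\<close>.\<close>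

lemma pmf_error_le:
  assumes hom: "g \<in> hom G H" and small: "distance g \<le> 1/4"
  shows "pmf (error_pmf g n) h \<le> 1/2 + (1 - 2 * distance g) ^ n / 2"
proof (induction n arbitrary: h)
  case 0
  show ?case by (simp add: pmf_le_1)
next
  case (Suc n)
  interpret g: group_hom G H g
    by unfold_locales (rule hom)
  show ?case
  proof (cases "h \<in> carrier H")
    case False
    have "h \<notin> set_pmf (error_pmf g (Suc n))"
      using False unfolding error_pmf_def by (auto dest!: walk_closed simp del: walk_pmf.simps)
    then show ?thesis using small unfolding set_pmf_iff by simp
  next
    case h: True
    let ?t = "map_pmf (\<lambda>(a, b). (g a \<otimes>\<^bsub>H\<^esub> h) \<otimes>\<^bsub>H\<^esub> inv\<^bsub>H\<^esub> b) step"
    have "pmf (error_pmf g (Suc n)) h = measure_pmf.prob (pair_pmf (walk n) step)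
        {((a, b), (a', b')). inv\<^bsub>H\<^esub> g (a \<otimes>\<^bsub>G\<^esub> a') \<otimes>\<^bsub>H\<^esub> (b \<otimes>\<^bsub>H\<^esub> b') = h}"
      unfolding error_pmf_def GH.walk_pmf_Suc_right[OF set_step] conv_pmf_def pmf_map measure_map_pmf
      by (rule arg_cong[where f = "measure_pmf.prob _"]) auto
    also have "\<dots> \<le> measure_pmf.prob (pair_pmf (walk n) step)
        {((a, b), (a', b')). inv\<^bsub>H\<^esub> g a \<otimes>\<^bsub>H\<^esub> b = (g a' \<otimes>\<^bsub>H\<^esub> h) \<otimes>\<^bsub>H\<^esub> inv\<^bsub>H\<^esub> b'}"
    proof (rule prob_mono, clarify)
      fix a b a' b'
      assume "((a, b), (a', b')) \<in> set_pmf (pair_pmf (walk n) step)"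
      then have "a \<in> carrier G" "b \<in> carrier H" "a' \<in> carrier G" "b' \<in> carrier H"
        using walk_closed[of a b n] step_closed[of a' b'] by simp_all
      then show "inv\<^bsub>H\<^esub> g a \<otimes>\<^bsub>H\<^esub> b =
          (g a' \<otimes>\<^bsub>H\<^esub> (inv\<^bsub>H\<^esub> g (a \<otimes>\<^bsub>G\<^esub> a') \<otimes>\<^bsub>H\<^esub> (b \<otimes>\<^bsub>H\<^esub> b'))) \<otimes>\<^bsub>H\<^esub> inv\<^bsub>H\<^esub> b'"
        by (simp add: H.inv_mult_group H.m_assoc H.mult_inv_cancel_left)
    qed
    also have "\<dots> = measure_pmf.prob (pair_pmf (error_pmf g n) ?t) {(x, y). x = y}"
      unfolding error_pmf_def map_pair[symmetric] measure_map_pmf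
      by (rule arg_cong[where f = "measure_pmf.prob _"]) auto
    also have "\<dots> \<le> 1/2 + (2 * (1/2 + (1 - 2 * distance g) ^ n / 2) - 1) * (2 * (1 - distance g) - 1) / 2"
      using small by (intro collision_le Suc.IH pmf_twisted_step_le hom small h) auto
    also have "\<dots> = 1/2 + (1 - 2 * distance g) ^ Suc n / 2"
      by simp
    finally show ?thesis .
  qed
qed

text \<open>The left-hand side is the error of the inverted walk, which has the law of the
  walk.\<close>

lemma map_twisted_walk:
  assumes hom: "g \<in> hom G H"
  shows "map_pmf (\<lambda>(a, b). g a \<otimes>\<^bsub>H\<^esub> inv\<^bsub>H\<^esub> b) (walk n) = error_pmf g n"
proof -
  interpret g: group_hom G H g
    by unfold_locales (rule hom)
  have "error_pmf g n = map_pmf (\<lambda>(a, b). inv\<^bsub>H\<^esub> g a \<otimes>\<^bsub>H\<^esub> b) (map_pmf (m_inv (G \<times>\<times> H)) (walk n))"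
    by (simp add: error_pmf_def map_inv_walk)
  also have "\<dots> = map_pmf (\<lambda>(a, b). g a \<otimes>\<^bsub>H\<^esub> inv\<^bsub>H\<^esub> b) (walk n)"
    unfolding map_pmf_comp using set_walk[of n]
    by (intro map_pmf_cong) (auto simp: inv_DirProd[OF G.group_axioms H.group_axioms] subset_iff)
  finally show ?thesis by simp
qed

text \<open>Cancelling turns \<open>b b' = g (a a')\<close> into a collision of two independent
  errors, each of bias at most (1 - 2 \<open>distance g\<close>)^n; the product of the biases gives
  the exponent 2 n.\<close>

lemma prob_walk_eq_hom_le:
  assumes hom: "g \<in> hom G H" and small: "distance g \<le> 1/4"
  shows "measure_pmf.prob (walk (2 * n)) {(a, b). b = g a} \<le> 1/2 + (1 - 2 * distance g) ^ (2 * n) / 2"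
proof -
  interpret g: group_hom G H g
    by unfold_locales (rule hom)
  have imp: "inv\<^bsub>H\<^esub> g a \<otimes>\<^bsub>H\<^esub> b = g a' \<otimes>\<^bsub>H\<^esub> inv\<^bsub>H\<^esub> b'"
    if [simp]: "a \<in> carrier G" "b \<in> carrier H" "a' \<in> carrier G" "b' \<in> carrier H"
      and eq: "b \<otimes>\<^bsub>H\<^esub> b' = g (a \<otimes>\<^bsub>G\<^esub> a')" for a b a' b'
  proof -
    have "inv\<^bsub>H\<^esub> g a \<otimes>\<^bsub>H\<^esub> b = inv\<^bsub>H\<^esub> g a \<otimes>\<^bsub>H\<^esub> (b \<otimes>\<^bsub>H\<^esub> b') \<otimes>\<^bsub>H\<^esub> inv\<^bsub>H\<^esub> b'"
      by (simp only: H.m_assoc H.m_closed H.inv_closed H.r_inv H.r_one g.hom_closed that(1-4))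
    also have "\<dots> = g a' \<otimes>\<^bsub>H\<^esub> inv\<^bsub>H\<^esub> b'"
      unfolding eq by (simp add: H.m_assoc H.mult_inv_cancel_left)
    finally show ?thesis .
  qed
  have "measure_pmf.prob (walk (2 * n)) {(a, b). b = g a} =
      measure_pmf.prob (pair_pmf (walk n) (walk n)) {((a, b), (a', b')). b \<otimes>\<^bsub>H\<^esub> b' = g (a \<otimes>\<^bsub>G\<^esub> a')}"
    unfolding mult_2 GH.walk_pmf_add[OF set_step] conv_pmf_def measure_map_pmf
    by (rule arg_cong[where f = "measure_pmf.prob _"]) auto
  also have "\<dots> \<le> measure_pmf.prob (pair_pmf (walk n) (walk n))
      {((a, b), (a', b')). inv\<^bsub>H\<^esub> g a \<otimes>\<^bsub>H\<^esub> b = g a' \<otimes>\<^bsub>H\<^esub> inv\<^bsub>H\<^esub> b'}"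
  proof (rule prob_mono, clarify)
    fix a b a' b'
    assume mem: "((a, b), (a', b')) \<in> set_pmf (pair_pmf (walk n) (walk n))"
      and eq: "b \<otimes>\<^bsub>H\<^esub> b' = g (a \<otimes>\<^bsub>G\<^esub> a')"
    from mem have "a \<in> carrier G" "b \<in> carrier H" "a' \<in> carrier G" "b' \<in> carrier H"
      using walk_closed[of a b n] walk_closed[of a' b' n] by simp_all
    from imp[OF this eq] show "inv\<^bsub>H\<^esub> g a \<otimes>\<^bsub>H\<^esub> b = g a' \<otimes>\<^bsub>H\<^esub> inv\<^bsub>H\<^esub> b'" .
  qed
  also have "\<dots> = measure_pmf.prob (pair_pmf (error_pmf g n)
      (map_pmf (\<lambda>(a, b). g a \<otimes>\<^bsub>H\<^esub> inv\<^bsub>H\<^esub> b) (walk n))) {(x, y). x = y}"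
    unfolding error_pmf_def map_pair[symmetric] measure_map_pmf
    by (rule arg_cong[where f = "measure_pmf.prob _"]) auto
  also have "\<dots> = measure_pmf.prob (pair_pmf (error_pmf g n) (error_pmf g n)) {(x, y). x = y}"
    by (simp add: map_twisted_walk[OF hom])
  also have "\<dots> \<le> 1/2 + (2 * (1/2 + (1 - 2 * distance g) ^ n / 2) - 1)
      * (2 * (1/2 + (1 - 2 * distance g) ^ n / 2) - 1) / 2"
    using small by (intro collision_le pmf_error_le hom small) auto
  also have "\<dots> = 1/2 + (1 - 2 * distance g) ^ (2 * n) / 2"
    by (simp add: power_even_eq power2_eq_square)
  finally show ?thesis .
qed

text \<open>A walk that misses \<open>g\<close> at its endpoint either is rejected or ends where
  \<open>f\<close> and \<open>g\<close> differ; the endpoint is uniform, so the latter costs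
  \<open>distance g\<close>.\<close>

lemma prob_reject_ge:
  assumes hom: "g \<in> hom G H" and small: "distance g \<le> 1/4" and "n > 0"
  shows "1/2 - (1 - 2 * distance g) ^ (2 * n) / 2 \<le>
    measure_pmf.prob (random_signs_test G H (2 * n) f) {Reject} + distance g"
proof -
  have "1/2 - (1 - 2 * distance g) ^ (2 * n) / 2 \<le> 1 - measure_pmf.prob (walk (2 * n)) {(a, b). b = g a}"
    using prob_walk_eq_hom_le[OF hom small, of n] by simp
  also have "\<dots> = measure_pmf.prob (walk (2 * n)) (- {(a, b). b = g a})"
    using measure_pmf.prob_compl[of "{(a, b). b = g a}" "walk (2 * n)"]
    by (simp add: Compl_eq_Diff_UNIV)
  also have "\<dots> \<le> measure_pmf.prob (walk (2 * n)) {(a, b). b \<noteq> f a} +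
      measure_pmf.prob (walk (2 * n)) {w. f (fst w) \<noteq> g (fst w)}"
    by (rule prob_le_add) auto
  also have "measure_pmf.prob (walk (2 * n)) {w. f (fst w) \<noteq> g (fst w)} = distance g"
    unfolding distance_def using map_fst_walk[of "2 * n"] \<open>n > 0\<close>
    by (intro prob_map_pmf_eq) auto
  finally show ?thesis by (simp add: prob_reject)
qed

end

section \<open>Combining the bounds\<close>

theorem theorem3p1:
  fixes G :: "('a, 'm) monoid_scheme" and H :: "('b, 'n) monoid_scheme"
    and f :: "'a \<Rightarrow> 'b" and k :: nat and \<epsilon> :: real
  assumes "0 < \<epsilon>" and "\<epsilon> < 1"
    and "group G" and "finite (carrier G)"
    and "group H" and "finite (carrier H)"
    and "f \<in> carrier G \<rightarrow> carrier H"
    and "far_from_hom G H \<epsilon> f"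
  shows "measure_pmf.prob (random_signs_test G H (2 * k) f) {Reject}
           \<ge> min ((2 * real k - 3) * \<epsilon> / 3) (1 / 16)"
proof (rule ccontr)
  assume neg: "\<not> ?thesis"
  interpret finite_group_map G H f
    using assms by (simp add: finite_group_map_def finite_group_map_axioms_def
        finite_group_def finite_group_axioms_def Pi_iff)
  define \<delta> where "\<delta> = measure_pmf.prob (random_signs_test G H (2 * k) f) {Reject}"
  have \<delta>: "\<delta> < 1/16" "\<delta> < (2 * real k - 3) * \<epsilon> / 3"
    using neg by (auto simp: \<delta>_def)
  have "0 \<le> \<delta>" by (simp add: \<delta>_def)
  \<comment> \<open>A negative or zero bound contradicts \<delta> \<ge> 0, so only k \<ge> 2
    remains.\<close>
  with \<delta>(2) have "0 < (2 * real k - 3) * \<epsilon>" by simp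
  with \<open>0 < \<epsilon>\<close> have k: "2 * real k - 3 > 0" by (simp add: zero_less_mult_iff)
  then have "k > 0" by (cases k) auto
  have defect: "defect \<le> 3 * \<delta>"
    using defect_le[OF \<open>k > 0\<close>] by (simp add: \<delta>_def prob_reject_double)
  with \<delta>(1) have "defect < 3/16" by simp
  then obtain g where hom: "g \<in> hom G H" and close: "3/4 * distance g \<le> defect"
    unfolding distance_def by (rule ex_close_hom)
  have small: "distance g < 1/4"
    using close defect \<delta>(1) by simp
  have "\<epsilon> < distance g"
    using assms(8) hom by (simp add: far_from_hom_def distance_def)
  \<comment> \<open>Bernoulli's inequality with exponent 2 k gives (1 + 2
    \<open>distance g\<close>)^(2 k) \<ge> 1 + t. Since (1 - 2 \<open>distance g\<close>)(1 + 2
    \<open>distance g\<close>) \<le> 1, the decay factor is at most \<open>w\<close>.\<close>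
  define t where "t = 4 * real k * distance g"
  define w where "w = 1 / (1 + t)"
  have "t \<ge> 0"
    using \<open>0 < \<epsilon>\<close> \<open>\<epsilon> < distance g\<close> by (simp add: t_def)
  have "(1 + t) * (1 - 2 * distance g) ^ (2 * k) \<le>
      (1 + 2 * distance g) ^ (2 * k) * (1 - 2 * distance g) ^ (2 * k)"
    using Bernoulli_inequality[of "2 * distance g" "2 * k"] \<open>0 < \<epsilon>\<close> \<open>\<epsilon> < distance g\<close> small
    by (intro mult_right_mono) (auto simp: t_def algebra_simps)
  also have "\<dots> = (1 - (2 * distance g)\<^sup>2) ^ (2 * k)"
    by (simp add: power2_eq_square algebra_simps flip: power_mult_distrib)
  also have "\<dots> \<le> 1"
    using power_le_one[of "2 * distance g" 2] \<open>0 < \<epsilon>\<close> \<open>\<epsilon> < distance g\<close> small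
    by (intro power_le_one) simp_all
  finally have "(1 - 2 * distance g) ^ (2 * k) \<le> w"
    using \<open>t \<ge> 0\<close> by (simp add: w_def field_simps)
  moreover have "1/2 - (1 - 2 * distance g) ^ (2 * k) / 2 \<le> \<delta> + distance g"
    using prob_reject_ge[OF hom _ \<open>k > 0\<close>] small by (simp add: \<delta>_def)
  ultimately have main: "1/2 - w / 2 \<le> \<delta> + distance g"
    by linarith
  show False
  \<comment> \<open>For t \<le> 2, 1/2 - w/2 = t / (2 (1 + t)) \<ge> t/6, and t/6 -
    \<open>distance g\<close> = (2 k - 3) \<open>distance g\<close> / 3.\<close>
  proof (cases "t \<le> 2")
    case True
    have "t * t \<le> 2 * t"
      using True \<open>t \<ge> 0\<close> by (rule mult_right_mono)
    then have "t / 6 \<le> 1/2 - w / 2"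
      using \<open>t \<ge> 0\<close> by (simp add: w_def field_simps)
    with main have "(2 * real k - 3) * distance g / 3 \<le> \<delta>"
      by (simp add: t_def field_simps)
    moreover have "(2 * real k - 3) * \<epsilon> \<le> (2 * real k - 3) * distance g"
      using k \<open>\<epsilon> < distance g\<close> by (intro mult_left_mono) auto
    ultimately show False using \<delta>(2) by simp
  next
    case False
    \<comment> \<open>This yields \<delta> + \<open>distance g\<close> \<ge> 1/3, whereas 1/16 + 1/4
      = 5/16 < 1/3.\<close>
    then have "w \<le> 1/3"
      by (simp add: w_def field_simps)
    with main small \<delta>(1) show False by simp
  qed
qed

end
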